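(* Let $C$ be a linear code of length $n$ over $R$ with associated codes $C_1,C_2,C_3\subseteq\mathbb{F}_{p^k}^n$. Then $C$ is a cyclic self-dual code of length $n$ over $R$ if and only if $C_1$, $C_2$ and $C_3$ are cyclic self-dual codes of length $n$ over $\mathbb{F}_{p^k}$.
   Context: Let $p$ be a prime, $k\ge1$ and $r>1$ integers with $\gcd(r,p)=1$, and $R_r=\mathbb{F}_{p^k}[v]/\langle v^{r+1}-v\rangle$. In $R_r$ put $e_1=\frac1r(v+v^2+\dots+v^r)$, $e_2=-\frac1r(v+\dots+v^{r-1})+\frac{r-1}{r}v^r$, $e_3=1-v^r$; these are nonzero orthogonal idempotents with sum $1$. $R$ denotes the subring $R=e_1\mathbb{F}_{p^k}\oplus e_2\mathbb{F}_{p^k}\oplus e_3\mathbb{F}_{p^k}$ of $R_r$. A linear code of length $n$ over a commutative ring $A$ is an $A$-submodule of $A^n$; it is cyclic if it is stable under $(c_0,\dots,c_{n-1})\mapsto(c_{n-1},c_0,\dots,c_{n-2})$, and self-dual if $C=C^\perp$, where $C^\perp=\{y\in A^n : \sum_j y_jc_j=0\ \forall c\in C\}$. For a linear code $C$ over $R$, the associated codes are $C_1=\{s : \exists\, t,u\in\mathbb{F}_{p^k}^n,\ e_1s+e_2t+e_3u\in C\}$, $C_2=\{t : \exists\, s,u\in\mathbb{F}_{p^k}^n,\ e_1s+e_2t+e_3u\in C\}$, $C_3=\{u : \exists\, s,t\in\mathbb{F}_{p^k}^n,\ e_1s+e_2t+e_3u\in C\}$. *)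

theory Defs
  imports "HOL-Algebra.Polynomial_Divisibility" "HOL-Algebra.Module" "HOL-Computational_Algebra.Primes"
begin

section \<open>Linear codes over a ring\<close>

text \<open>Words of length \<open>n\<close> are extensional functions on \<open>{..<n}\<close>. The multiplicative fields of the
  record are the componentwise ones; only the module operations are relevant below.\<close>

definition power_module :: "('a, 'b) ring_scheme \<Rightarrow> nat \<Rightarrow> ('a, nat \<Rightarrow> 'a) module" where
  "power_module A n =
     \<lparr> carrier = {..<n} \<rightarrow>\<^sub>E carrier A,
       mult = (\<lambda>x y. \<lambda>i\<in>{..<n}. x i \<otimes>\<^bsub>A\<^esub> y i),
       one = (\<lambda>i\<in>{..<n}. \<one>\<^bsub>A\<^esub>),
       zero = (\<lambda>i\<in>{..<n}. \<zero>\<^bsub>A\<^esub>),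
       add = (\<lambda>x y. \<lambda>i\<in>{..<n}. x i \<oplus>\<^bsub>A\<^esub> y i),
       smult = (\<lambda>a x. \<lambda>i\<in>{..<n}. a \<otimes>\<^bsub>A\<^esub> x i) \<rparr>"

definition linear_code :: "('a, 'b) ring_scheme \<Rightarrow> nat \<Rightarrow> (nat \<Rightarrow> 'a) set \<Rightarrow> bool" where
  "linear_code A n C \<longleftrightarrow> submodule C A (power_module A n)"

definition cyclic_shift :: "nat \<Rightarrow> (nat \<Rightarrow> 'a) \<Rightarrow> nat \<Rightarrow> 'a" where
  "cyclic_shift n c = (\<lambda>i\<in>{..<n}. if i = 0 then c (n - 1) else c (i - 1))"

definition cyclic_code :: "('a, 'b) ring_scheme \<Rightarrow> nat \<Rightarrow> (nat \<Rightarrow> 'a) set \<Rightarrow> bool" where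
  "cyclic_code A n C \<longleftrightarrow> linear_code A n C \<and> (\<forall>c\<in>C. cyclic_shift n c \<in> C)"

definition dual_code :: "('a, 'b) ring_scheme \<Rightarrow> nat \<Rightarrow> (nat \<Rightarrow> 'a) set \<Rightarrow> (nat \<Rightarrow> 'a) set" where
  "dual_code A n C =
     {y \<in> carrier (power_module A n). \<forall>c\<in>C. (\<Oplus>\<^bsub>A\<^esub>j\<in>{..<n}. y j \<otimes>\<^bsub>A\<^esub> c j) = \<zero>\<^bsub>A\<^esub>}"

definition self_dual_code :: "('a, 'b) ring_scheme \<Rightarrow> nat \<Rightarrow> (nat \<Rightarrow> 'a) set \<Rightarrow> bool" where
  "self_dual_code A n C \<longleftrightarrow> linear_code A n C \<and> C = dual_code A n C"


section \<open>The ring \<open>F[v]/(v\<^sup>r\<^sup>+\<^sup>1 - v)\<close> and its subring\<close>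

definition quot_poly :: "('a, 'b) ring_scheme \<Rightarrow> nat \<Rightarrow> 'a list" where
  "quot_poly F r =
     X\<^bsub>F\<^esub> [^]\<^bsub>(carrier F)[X]\<^bsub>F\<^esub>\<^esub> (r + 1) \<ominus>\<^bsub>(carrier F)[X]\<^bsub>F\<^esub>\<^esub> X\<^bsub>F\<^esub>"

definition quot_ring :: "('a, 'b) ring_scheme \<Rightarrow> nat \<Rightarrow> 'a list set ring" where
  "quot_ring F r = Rupt\<^bsub>F\<^esub> (carrier F) (quot_poly F r)"

definition quot_class :: "('a, 'b) ring_scheme \<Rightarrow> nat \<Rightarrow> 'a list \<Rightarrow> 'a list set" where
  "quot_class F r q =
     (PIdl\<^bsub>(carrier F)[X]\<^bsub>F\<^esub>\<^esub> (quot_poly F r)) +>\<^bsub>(carrier F)[X]\<^bsub>F\<^esub>\<^esub> q"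

definition vv :: "('a, 'b) ring_scheme \<Rightarrow> nat \<Rightarrow> 'a list set" where
  "vv F r = quot_class F r X\<^bsub>F\<^esub>"

definition scalar :: "('a, 'b) ring_scheme \<Rightarrow> nat \<Rightarrow> 'a \<Rightarrow> 'a list set" where
  "scalar F r a = quot_class F r (ring.poly_of_const F a)"

text \<open>The fractions \<open>1/r\<close> and \<open>(r-1)/r\<close> are formed in \<open>F\<close>, where \<open>r\<close> is read as \<open>r \<cdot> 1\<close>.\<close>

definition e1 :: "('a, 'b) ring_scheme \<Rightarrow> nat \<Rightarrow> 'a list set" where
  "e1 F r =
     scalar F r (inv\<^bsub>F\<^esub> ([r] \<cdot>\<^bsub>F\<^esub> \<one>\<^bsub>F\<^esub>))
       \<otimes>\<^bsub>quot_ring F r\<^esub> (\<Oplus>\<^bsub>quot_ring F r\<^esub>i\<in>{1..r}. vv F r [^]\<^bsub>quot_ring F r\<^esub> i)"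

definition e2 :: "('a, 'b) ring_scheme \<Rightarrow> nat \<Rightarrow> 'a list set" where
  "e2 F r =
     (\<ominus>\<^bsub>quot_ring F r\<^esub> (scalar F r (inv\<^bsub>F\<^esub> ([r] \<cdot>\<^bsub>F\<^esub> \<one>\<^bsub>F\<^esub>))
        \<otimes>\<^bsub>quot_ring F r\<^esub> (\<Oplus>\<^bsub>quot_ring F r\<^esub>i\<in>{1..r - 1}. vv F r [^]\<^bsub>quot_ring F r\<^esub> i)))
     \<oplus>\<^bsub>quot_ring F r\<^esub>
     scalar F r (([(r - 1)] \<cdot>\<^bsub>F\<^esub> \<one>\<^bsub>F\<^esub>) \<otimes>\<^bsub>F\<^esub> inv\<^bsub>F\<^esub> ([r] \<cdot>\<^bsub>F\<^esub> \<one>\<^bsub>F\<^esub>))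
       \<otimes>\<^bsub>quot_ring F r\<^esub> (vv F r [^]\<^bsub>quot_ring F r\<^esub> r)"

definition e3 :: "('a, 'b) ring_scheme \<Rightarrow> nat \<Rightarrow> 'a list set" where
  "e3 F r = \<one>\<^bsub>quot_ring F r\<^esub> \<ominus>\<^bsub>quot_ring F r\<^esub> (vv F r [^]\<^bsub>quot_ring F r\<^esub> r)"

definition idem_comb :: "('a, 'b) ring_scheme \<Rightarrow> nat \<Rightarrow> 'a \<Rightarrow> 'a \<Rightarrow> 'a \<Rightarrow> 'a list set" where
  "idem_comb F r a b c =
     e1 F r \<otimes>\<^bsub>quot_ring F r\<^esub> scalar F r a
     \<oplus>\<^bsub>quot_ring F r\<^esub> e2 F r \<otimes>\<^bsub>quot_ring F r\<^esub> scalar F r b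
     \<oplus>\<^bsub>quot_ring F r\<^esub> e3 F r \<otimes>\<^bsub>quot_ring F r\<^esub> scalar F r c"

definition sub_ring :: "('a, 'b) ring_scheme \<Rightarrow> nat \<Rightarrow> 'a list set ring" where
  "sub_ring F r = (quot_ring F r)
     \<lparr> carrier := {idem_comb F r a b c | a b c. a \<in> carrier F \<and> b \<in> carrier F \<and> c \<in> carrier F} \<rparr>"


section \<open>The associated codes\<close>

definition word_comb ::
  "('a, 'b) ring_scheme \<Rightarrow> nat \<Rightarrow> nat \<Rightarrow> (nat \<Rightarrow> 'a) \<Rightarrow> (nat \<Rightarrow> 'a) \<Rightarrow> (nat \<Rightarrow> 'a) \<Rightarrow> nat \<Rightarrow> 'a list set"
where
  "word_comb F r n s t u = (\<lambda>j\<in>{..<n}. idem_comb F r (s j) (t j) (u j))"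

definition assoc_code1 ::
  "('a, 'b) ring_scheme \<Rightarrow> nat \<Rightarrow> nat \<Rightarrow> (nat \<Rightarrow> 'a list set) set \<Rightarrow> (nat \<Rightarrow> 'a) set" where
  "assoc_code1 F r n C =
     {s \<in> carrier (power_module F n).
        \<exists>t \<in> carrier (power_module F n). \<exists>u \<in> carrier (power_module F n).
          word_comb F r n s t u \<in> C}"

definition assoc_code2 ::
  "('a, 'b) ring_scheme \<Rightarrow> nat \<Rightarrow> nat \<Rightarrow> (nat \<Rightarrow> 'a list set) set \<Rightarrow> (nat \<Rightarrow> 'a) set" where
  "assoc_code2 F r n C =
     {t \<in> carrier (power_module F n).
        \<exists>s \<in> carrier (power_module F n). \<exists>u \<in> carrier (power_module F n).
          word_comb F r n s t u \<in> C}"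

definition assoc_code3 ::
  "('a, 'b) ring_scheme \<Rightarrow> nat \<Rightarrow> nat \<Rightarrow> (nat \<Rightarrow> 'a list set) set \<Rightarrow> (nat \<Rightarrow> 'a) set" where
  "assoc_code3 F r n C =
     {u \<in> carrier (power_module F n).
        \<exists>s \<in> carrier (power_module F n). \<exists>t \<in> carrier (power_module F n).
          word_comb F r n s t u \<in> C}"

end

theory Submission
  imports Defs
begin

text \<open>Put \<open>s = v + \<dots> + v\<^sup>r\<close> and \<open>w = v\<^sup>r\<close>. From \<open>v\<^sup>r\<^sup>+\<^sup>1 = v\<close> one gets \<open>v s = s\<close>, hence
  \<open>s\<^sup>2 = r s\<close>, \<open>w s = s\<close> and \<open>w\<^sup>2 = w\<close>, so \<open>e1 = s / r\<close>, \<open>e2 = w - e1\<close> and \<open>e3 = 1 - w\<close> are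
  orthogonal idempotents with sum \<open>1\<close>; they do not vanish, as one sees by evaluating at \<open>1\<close> and
  \<open>0\<close> and by a degree comparison. Therefore \<open>R\<close> is isomorphic to \<open>F \<times> F \<times> F\<close>. Over a finite product
  of rings a linear code is the product of its images under the projections, because it is stable
  under multiplication by the idempotents; shifts and inner products are computed componentwise, so
  cyclicity and self-duality can be checked on each component.\<close>

section \<open>Codes over a finite product of rings\<close>

lemma power_module_sel [simp]:
  "carrier (power_module A n) = {..<n} \<rightarrow>\<^sub>E carrier A"
  "\<zero>\<^bsub>power_module A n\<^esub> = (\<lambda>i\<in>{..<n}. \<zero>\<^bsub>A\<^esub>)"
  "x \<oplus>\<^bsub>power_module A n\<^esub> y = (\<lambda>i\<in>{..<n}. x i \<oplus>\<^bsub>A\<^esub> y i)"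
  "a \<odot>\<^bsub>power_module A n\<^esub> x = (\<lambda>i\<in>{..<n}. a \<otimes>\<^bsub>A\<^esub> x i)"
  by (simp_all add: power_module_def)

lemma power_module_is_module:
  assumes "cring A"
  shows "module A (power_module A n)"
proof -
  interpret cring A by fact
  let ?M = "power_module A n"
  \<comment> \<open>Membership is split into extensionality and a pointwise condition, so that the
    module axioms reduce to ring axioms at each position.\<close>
  have [simp]: "x \<in> {..<n} \<rightarrow>\<^sub>E carrier A \<longleftrightarrow> x \<in> extensional {..<n} \<and> (\<forall>j<n. x j \<in> carrier A)" for x
    by (auto simp: PiE_iff)
  show ?thesis
  proof (intro moduleI abelian_groupI)
    fix x assume x: "x \<in> carrier ?M"
    show "\<exists>y\<in>carrier ?M. y \<oplus>\<^bsub>?M\<^esub> x = \<zero>\<^bsub>?M\<^esub>"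
      by (rule bexI[of _ "\<lambda>j\<in>{..<n}. \<ominus>\<^bsub>A\<^esub> x j"])
         (use x in \<open>simp_all add: l_neg cong: restrict_cong\<close>)
    show "\<zero>\<^bsub>?M\<^esub> \<oplus>\<^bsub>?M\<^esub> x = x" "\<one>\<^bsub>A\<^esub> \<odot>\<^bsub>?M\<^esub> x = x"
      using x by (auto intro!: extensionalityI[of _ "{..<n}"])
    fix y assume "y \<in> carrier ?M"
    with x show "x \<oplus>\<^bsub>?M\<^esub> y = y \<oplus>\<^bsub>?M\<^esub> x"
      by (simp add: a_comm cong: restrict_cong)
  qed (simp_all add: is_cring a_assoc m_assoc l_distr r_distr cong: restrict_cong)
qed

text \<open>Closure under negation follows from closure under scalars, because
  \<open>- x = (- 1) x\<close>.\<close>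

lemma linear_codeI:
  assumes "cring A" and "C \<subseteq> {..<n} \<rightarrow>\<^sub>E carrier A" and "(\<lambda>j\<in>{..<n}. \<zero>\<^bsub>A\<^esub>) \<in> C"
    and "\<And>x y. \<lbrakk>x \<in> C; y \<in> C\<rbrakk> \<Longrightarrow> (\<lambda>j\<in>{..<n}. x j \<oplus>\<^bsub>A\<^esub> y j) \<in> C"
    and smult: "\<And>a x. \<lbrakk>a \<in> carrier A; x \<in> C\<rbrakk> \<Longrightarrow> (\<lambda>j\<in>{..<n}. a \<otimes>\<^bsub>A\<^esub> x j) \<in> C"
  shows "linear_code A n C"
proof -
  interpret cring A by fact
  interpret module A "power_module A n"
    by (rule power_module_is_module) fact
  show ?thesis
    unfolding linear_code_def
  proof (rule submoduleI)
    fix x assume x: "x \<in> C"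
    with assms(2) have xc: "x \<in> carrier (power_module A n)"
      by auto
    have "\<ominus>\<^bsub>power_module A n\<^esub> x = (\<ominus>\<^bsub>A\<^esub> \<one>\<^bsub>A\<^esub>) \<odot>\<^bsub>power_module A n\<^esub> x"
      using smult_l_minus[OF one_closed xc] smult_one[OF xc] by simp
    also have "\<dots> \<in> C"
      using smult[OF _ x, of "\<ominus>\<^bsub>A\<^esub> \<one>\<^bsub>A\<^esub>"] by simp
    finally show "\<ominus>\<^bsub>power_module A n\<^esub> x \<in> C" .
  qed (use assms in simp_all)
qed

lemma linear_codeD:
  assumes "linear_code A n C"
  shows "C \<subseteq> {..<n} \<rightarrow>\<^sub>E carrier A" and "(\<lambda>j\<in>{..<n}. \<zero>\<^bsub>A\<^esub>) \<in> C"
    and "\<lbrakk>x \<in> C; y \<in> C\<rbrakk> \<Longrightarrow> (\<lambda>j\<in>{..<n}. x j \<oplus>\<^bsub>A\<^esub> y j) \<in> C"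
    and "\<lbrakk>a \<in> carrier A; x \<in> C\<rbrakk> \<Longrightarrow> (\<lambda>j\<in>{..<n}. a \<otimes>\<^bsub>A\<^esub> x j) \<in> C"
proof -
  interpret submodule C A "power_module A n"
    using assms by (simp add: linear_code_def)
  show "C \<subseteq> {..<n} \<rightarrow>\<^sub>E carrier A" "(\<lambda>j\<in>{..<n}. \<zero>\<^bsub>A\<^esub>) \<in> C"
    using subset one_closed by simp_all
  show "(\<lambda>j\<in>{..<n}. x j \<oplus>\<^bsub>A\<^esub> y j) \<in> C" if "x \<in> C" "y \<in> C"
    using m_closed[OF that] by simp
  show "(\<lambda>j\<in>{..<n}. a \<otimes>\<^bsub>A\<^esub> x j) \<in> C" if "a \<in> carrier A" "x \<in> C"
    using smult_closed[OF that] by simp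
qed

lemma linear_code_mem:
  assumes "linear_code A n C" and "c \<in> C" and "j < n"
  shows "c j \<in> carrier A"
  using linear_codeD(1)[OF assms(1)] assms(2,3) by auto

section \<open>Words under maps applied at each position\<close>

definition map_word :: "nat \<Rightarrow> ('c \<Rightarrow> 'a) \<Rightarrow> (nat \<Rightarrow> 'c) \<Rightarrow> nat \<Rightarrow> 'a" where
  "map_word n f c = (\<lambda>j\<in>{..<n}. f (c j))"

lemma map_word_apply [simp]: "j < n \<Longrightarrow> map_word n f c j = f (c j)"
  by (simp add: map_word_def)

lemma map_word_PiE: "(\<And>j. j < n \<Longrightarrow> f (c j) \<in> B) \<Longrightarrow> map_word n f c \<in> {..<n} \<rightarrow>\<^sub>E B"
  by (auto simp: map_word_def)

lemma map_word_cyclic_shift: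
  "map_word n f (cyclic_shift n c) = cyclic_shift n (map_word n f c)"
  by (auto simp: map_word_def cyclic_shift_def fun_eq_iff)

text \<open>\<open>S\<close> is the product of the rings \<open>A i\<close>, with projections \<open>\<pi> i\<close>.\<close>

locale ring_decomposition =
  fixes I :: "'i set" and S :: "('c, 'd) ring_scheme"
    and A :: "'i \<Rightarrow> ('a, 'b) ring_scheme" and \<pi> :: "'i \<Rightarrow> 'c \<Rightarrow> 'a"
  assumes finite_I: "finite I"
    and cring_S: "cring S"
    and cring_A: "i \<in> I \<Longrightarrow> cring (A i)"
    and hom: "i \<in> I \<Longrightarrow> \<pi> i \<in> ring_hom S (A i)"
    and inj: "\<lbrakk>x \<in> carrier S; y \<in> carrier S; \<And>i. i \<in> I \<Longrightarrow> \<pi> i x = \<pi> i y\<rbrakk> \<Longrightarrow> x = y"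
    and surj: "(\<And>i. i \<in> I \<Longrightarrow> a i \<in> carrier (A i)) \<Longrightarrow> \<exists>x\<in>carrier S. \<forall>i\<in>I. \<pi> i x = a i"
begin

lemma hom_ring: "i \<in> I \<Longrightarrow> ring_hom_cring S (A i) (\<pi> i)"
  by (simp add: ring_hom_cring_def ring_hom_cring_axioms_def cring_S cring_A hom)

lemma component_closed:
  assumes "i \<in> I"
  shows component_zero_closed: "\<zero>\<^bsub>A i\<^esub> \<in> carrier (A i)" and component_one_closed: "\<one>\<^bsub>A i\<^esub> \<in> carrier (A i)"
proof -
  interpret cring "A i"
    by (rule cring_A) fact
  show "\<zero>\<^bsub>A i\<^esub> \<in> carrier (A i)" "\<one>\<^bsub>A i\<^esub> \<in> carrier (A i)"
    by simp_all
qed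

lemma word_ext:
  assumes "x \<in> {..<n} \<rightarrow>\<^sub>E carrier S" and "y \<in> {..<n} \<rightarrow>\<^sub>E carrier S"
    and "\<And>i. i \<in> I \<Longrightarrow> map_word n (\<pi> i) x = map_word n (\<pi> i) y"
  shows "x = y"
proof (rule PiE_ext[OF assms(1,2)])
  fix j assume j: "j \<in> {..<n}"
  show "x j = y j"
  proof (rule inj)
    show "\<pi> i (x j) = \<pi> i (y j)" if "i \<in> I" for i
      using fun_cong[OF assms(3)[OF that], of j] j by simp
  qed (use j PiE_mem[OF assms(1)] PiE_mem[OF assms(2)] in auto)
qed

text \<open>Joint surjectivity of the projections is applied at each position separately, and the
  preimages are collected by choice.\<close>

lemma word_exists:
  assumes "\<And>i. i \<in> I \<Longrightarrow> a i \<in> {..<n} \<rightarrow>\<^sub>E carrier (A i)"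
  obtains x where "x \<in> {..<n} \<rightarrow>\<^sub>E carrier S" and "\<And>i. i \<in> I \<Longrightarrow> map_word n (\<pi> i) x = a i"
proof -
  have "\<exists>x. \<forall>j\<in>{..<n}. x j \<in> carrier S \<and> (\<forall>i\<in>I. \<pi> i (x j) = a i j)"
  proof (intro bchoice ballI)
    fix j assume "j \<in> {..<n}"
    then have "\<exists>x\<in>carrier S. \<forall>i\<in>I. \<pi> i x = a i j"
      by (intro surj PiE_mem[OF assms])
    then show "\<exists>x. x \<in> carrier S \<and> (\<forall>i\<in>I. \<pi> i x = a i j)"
      by blast
  qed
  then obtain x where x: "\<And>j. j < n \<Longrightarrow> x j \<in> carrier S"
      "\<And>i j. \<lbrakk>j < n; i \<in> I\<rbrakk> \<Longrightarrow> \<pi> i (x j) = a i j"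
    by auto
  show thesis
  proof
    show "restrict x {..<n} \<in> {..<n} \<rightarrow>\<^sub>E carrier S"
      using x by auto
    show "map_word n (\<pi> i) (restrict x {..<n}) = a i" if "i \<in> I" for i
      using x(2) that by (intro PiE_ext[OF _ assms[OF that]] map_word_PiE)
        (use x that PiE_mem[OF assms[OF that]] in auto)
  qed
qed

text \<open>These are the unit vectors of the product: multiplication by one of them keeps a single
  component of a codeword and kills the others.\<close>

lemma idempotent:
  assumes "i \<in> I"
  obtains e where "e \<in> carrier S" and "\<pi> i e = \<one>\<^bsub>A i\<^esub>"
    and "\<And>k. \<lbrakk>k \<in> I; k \<noteq> i\<rbrakk> \<Longrightarrow> \<pi> k e = \<zero>\<^bsub>A k\<^esub>"
proof -
  have "\<exists>e\<in>carrier S. \<forall>k\<in>I. \<pi> k e = (if k = i then \<one>\<^bsub>A k\<^esub> else \<zero>\<^bsub>A k\<^esub>)"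
    using assms by (intro surj) (simp add: component_zero_closed component_one_closed)
  with assms that show thesis
    by auto
qed

text \<open>The image is stable under scalars of \<open>A i\<close> because each of them lifts to a
  scalar of \<open>S\<close>.\<close>

lemma linear_code_map_word:
  assumes lin: "linear_code S n C" and i: "i \<in> I"
  shows "linear_code (A i) n (map_word n (\<pi> i) ` C)"
proof -
  interpret ring_hom_cring S "A i" "\<pi> i"
    by (rule hom_ring) fact
  note mem = linear_code_mem[OF lin]
  show ?thesis
  proof (rule linear_codeI)
    show "map_word n (\<pi> i) ` C \<subseteq> {..<n} \<rightarrow>\<^sub>E carrier (A i)"
      by (intro image_subsetI map_word_PiE hom_closed mem)
    have "map_word n (\<pi> i) (\<lambda>j\<in>{..<n}. \<zero>\<^bsub>S\<^esub>) = (\<lambda>j\<in>{..<n}. \<zero>\<^bsub>A i\<^esub>)"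
      by (simp add: map_word_def cong: restrict_cong)
    then show "(\<lambda>j\<in>{..<n}. \<zero>\<^bsub>A i\<^esub>) \<in> map_word n (\<pi> i) ` C"
      using linear_codeD(2)[OF lin] by (metis imageI)
  next
    fix x y assume "x \<in> map_word n (\<pi> i) ` C" "y \<in> map_word n (\<pi> i) ` C"
    then obtain c d where cd: "c \<in> C" "d \<in> C"
      and [simp]: "x = map_word n (\<pi> i) c" "y = map_word n (\<pi> i) d"
      by auto
    have "(\<lambda>j\<in>{..<n}. x j \<oplus>\<^bsub>A i\<^esub> y j) = map_word n (\<pi> i) (\<lambda>j\<in>{..<n}. c j \<oplus>\<^bsub>S\<^esub> d j)"
      using cd mem by (simp add: map_word_def cong: restrict_cong)
    then show "(\<lambda>j\<in>{..<n}. x j \<oplus>\<^bsub>A i\<^esub> y j) \<in> map_word n (\<pi> i) ` C"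
      using linear_codeD(3)[OF lin cd] by simp
  next
    fix a x assume "a \<in> carrier (A i)" "x \<in> map_word n (\<pi> i) ` C"
    then obtain c where c: "c \<in> C" and [simp]: "x = map_word n (\<pi> i) c"
      by auto
    \<comment> \<open>Zero is a default value for the other components of the lift; only component
      \<open>i\<close> is looked at.\<close>
    have "\<exists>b\<in>carrier S. \<forall>k\<in>I. \<pi> k b = (if k = i then a else \<zero>\<^bsub>A k\<^esub>)"
      using \<open>a \<in> carrier (A i)\<close> by (intro surj) (simp add: component_zero_closed)
    then obtain b where b: "b \<in> carrier S" "\<pi> i b = a"
      using i by auto
    have "(\<lambda>j\<in>{..<n}. a \<otimes>\<^bsub>A i\<^esub> x j) = map_word n (\<pi> i) (\<lambda>j\<in>{..<n}. b \<otimes>\<^bsub>S\<^esub> c j)"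
      using b c mem by (simp add: map_word_def cong: restrict_cong)
    then show "(\<lambda>j\<in>{..<n}. a \<otimes>\<^bsub>A i\<^esub> x j) \<in> map_word n (\<pi> i) ` C"
      using linear_codeD(4)[OF lin b(1) c] by simp
  qed (rule S.is_cring)
qed

text \<open>The components of \<open>x\<close> may come from different codewords. Multiplying each
  of these by its idempotent and adding up glues them into one codeword, which equals
  \<open>x\<close> by joint injectivity.\<close>

lemma mem_code_iff:
  assumes lin: "linear_code S n C" and x: "x \<in> {..<n} \<rightarrow>\<^sub>E carrier S"
  shows "x \<in> C \<longleftrightarrow> (\<forall>i\<in>I. map_word n (\<pi> i) x \<in> map_word n (\<pi> i) ` C)"
proof
  assume comp: "\<forall>i\<in>I. map_word n (\<pi> i) x \<in> map_word n (\<pi> i) ` C"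
  note mem = linear_code_mem[OF lin]
  \<comment> \<open>The gluing proceeds by induction on the set \<open>J\<close> of components
    already matched, with zero in all others.\<close>
  have "\<exists>d\<in>C. \<forall>i\<in>I. \<forall>j<n. \<pi> i (d j) = (if i \<in> J then \<pi> i (x j) else \<zero>\<^bsub>A i\<^esub>)"
    if "finite J" "J \<subseteq> I" for J
    using that
  proof (induction J)
    case empty
    have "\<pi> i \<zero>\<^bsub>S\<^esub> = \<zero>\<^bsub>A i\<^esub>" if "i \<in> I" for i
      using ring_hom_cring.hom_zero[OF hom_ring[OF that]] .
    then show ?case
      using linear_codeD(2)[OF lin] by (intro bexI[of _ "\<lambda>j\<in>{..<n}. \<zero>\<^bsub>S\<^esub>"]) auto
  next
    case (insert k J)
    then obtain d where d: "d \<in> C"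
      "\<And>i j. \<lbrakk>i \<in> I; j < n\<rbrakk> \<Longrightarrow> \<pi> i (d j) = (if i \<in> J then \<pi> i (x j) else \<zero>\<^bsub>A i\<^esub>)"
      by auto
    obtain c where c: "c \<in> C" and cx: "map_word n (\<pi> k) x = map_word n (\<pi> k) c"
      using comp insert.prems by auto
    obtain e where e: "e \<in> carrier S" "\<pi> k e = \<one>\<^bsub>A k\<^esub>"
      and e0: "\<And>i. \<lbrakk>i \<in> I; i \<noteq> k\<rbrakk> \<Longrightarrow> \<pi> i e = \<zero>\<^bsub>A i\<^esub>"
      using idempotent[of k] insert.prems by auto
    \<comment> \<open>The word \<open>e c\<close> agrees with \<open>x\<close> in component
      \<open>k\<close> and vanishes in the others, while \<open>d\<close> vanishes in component
      \<open>k\<close> because \<open>k\<close> is not in \<open>J\<close>. Their sum is therefore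
      right on \<open>insert k J\<close>.\<close>
    let ?ec = "\<lambda>j\<in>{..<n}. e \<otimes>\<^bsub>S\<^esub> c j"
    let ?d = "\<lambda>j\<in>{..<n}. d j \<oplus>\<^bsub>S\<^esub> ?ec j"
    have "?d \<in> C"
      by (intro linear_codeD(3)[OF lin] linear_codeD(4)[OF lin] c d e)
    moreover have "\<pi> i (?d j) = (if i \<in> insert k J then \<pi> i (x j) else \<zero>\<^bsub>A i\<^esub>)"
      if i: "i \<in> I" and j: "j < n" for i j
    proof -
      interpret ring_hom_cring S "A i" "\<pi> i"
        by (rule hom_ring) fact
      have "x j \<in> carrier S"
        using x j by auto
      moreover have "\<pi> i (x j) = \<pi> i (c j)" if "i = k"
        using fun_cong[OF cx, of j] j that by simp
      ultimately show ?thesis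
        using insert.hyps i j e e0[OF i] d(2)[OF i j] mem[OF c j] mem[OF d(1) j]
        by (cases "k = i") simp_all
    qed
    ultimately show ?case
      by (intro bexI[of _ ?d]) blast+
  qed
  from this[OF finite_I order_refl] obtain d where d: "d \<in> C"
    "\<And>i j. \<lbrakk>i \<in> I; j < n\<rbrakk> \<Longrightarrow> \<pi> i (d j) = \<pi> i (x j)"
    by auto
  have "x = d"
    using x d linear_codeD(1)[OF lin] by (intro word_ext[of _ n]) (auto simp: map_word_def)
  with d show "x \<in> C"
    by simp
qed auto

text \<open>The shift only moves positions, so it commutes with the projections; membership of a
  shifted word is then tested by \<open>mem_code_iff\<close>.\<close>

lemma cyclic_code_iff:
  assumes lin: "linear_code S n C"
  shows "cyclic_code S n C \<longleftrightarrow> (\<forall>i\<in>I. cyclic_code (A i) n (map_word n (\<pi> i) ` C))"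
proof
  assume "cyclic_code S n C"
  then show "\<forall>i\<in>I. cyclic_code (A i) n (map_word n (\<pi> i) ` C)"
    by (auto simp: cyclic_code_def linear_code_map_word simp flip: map_word_cyclic_shift)
next
  assume comp: "\<forall>i\<in>I. cyclic_code (A i) n (map_word n (\<pi> i) ` C)"
  have "cyclic_shift n c \<in> C" if c: "c \<in> C" for c
  proof -
    have "cyclic_shift n c \<in> {..<n} \<rightarrow>\<^sub>E carrier S"
      using linear_code_mem[OF lin c] by (auto simp: cyclic_shift_def)
    with comp c show ?thesis
      by (simp add: mem_code_iff[OF lin] map_word_cyclic_shift cyclic_code_def)
  qed
  with lin show "cyclic_code S n C"
    by (simp add: cyclic_code_def)
qed

text \<open>A projection is a ring homomorphism, so it maps inner products to inner products, and by
  joint injectivity an element of \<open>S\<close> is zero exactly if all its projections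
  are.\<close>

lemma mem_dual_code_iff:
  assumes C: "C \<subseteq> {..<n} \<rightarrow>\<^sub>E carrier S" and y: "y \<in> {..<n} \<rightarrow>\<^sub>E carrier S"
  shows "y \<in> dual_code S n C \<longleftrightarrow>
    (\<forall>i\<in>I. map_word n (\<pi> i) y \<in> dual_code (A i) n (map_word n (\<pi> i) ` C))"
proof -
  let ?ip = "\<lambda>c. \<Oplus>\<^bsub>S\<^esub>j\<in>{..<n}. y j \<otimes>\<^bsub>S\<^esub> c j"
  have zero: "\<zero>\<^bsub>S\<^esub> \<in> carrier S" and closed: "c \<in> C \<Longrightarrow> ?ip c \<in> carrier S" for c
  proof -
    interpret cring S by (rule cring_S)
    show "\<zero>\<^bsub>S\<^esub> \<in> carrier S"
      by simp
    show "?ip c \<in> carrier S" if "c \<in> C"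
      using C y that by (intro finsum_closed Pi_I m_closed) auto
  qed
  have proj: "\<pi> i (?ip c) =
      (\<Oplus>\<^bsub>A i\<^esub>j\<in>{..<n}. map_word n (\<pi> i) y j \<otimes>\<^bsub>A i\<^esub> map_word n (\<pi> i) c j)"
    if i: "i \<in> I" and c: "c \<in> C" for i c
  proof -
    interpret ring_hom_cring S "A i" "\<pi> i"
      by (rule hom_ring) fact
    have yc: "y j \<in> carrier S" "c j \<in> carrier S" if "j < n" for j
      using C y c that by auto
    then have "\<pi> i (?ip c) = (\<Oplus>\<^bsub>A i\<^esub>j\<in>{..<n}. \<pi> i (y j \<otimes>\<^bsub>S\<^esub> c j))"
      by (subst hom_finsum) (auto simp: comp_def)
    also have "\<dots> = (\<Oplus>\<^bsub>A i\<^esub>j\<in>{..<n}. map_word n (\<pi> i) y j \<otimes>\<^bsub>A i\<^esub> map_word n (\<pi> i) c j)"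
      using yc by (intro S.finsum_cong') auto
    finally show ?thesis .
  qed
  have "map_word n (\<pi> i) y \<in> {..<n} \<rightarrow>\<^sub>E carrier (A i)" if i: "i \<in> I" for i
    using y by (intro map_word_PiE ring_hom_closed[OF hom[OF i]]) auto
  moreover have "?ip c = \<zero>\<^bsub>S\<^esub> \<longleftrightarrow> (\<forall>i\<in>I. \<pi> i (?ip c) = \<zero>\<^bsub>A i\<^esub>)" if "c \<in> C" for c
    using inj[OF closed[OF that] zero] ring_hom_cring.hom_zero[OF hom_ring] by auto
  ultimately show ?thesis
    using y by (auto simp: dual_code_def proj)
qed

text \<open>Membership in \<open>C\<close> and in its dual is decided by the projections. The point
  that needs work is that, for self-dual \<open>C\<close>, a word orthogonal to one projected code
  is the projection of a codeword.\<close>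

lemma self_dual_code_iff:
  assumes lin: "linear_code S n C"
  shows "self_dual_code S n C \<longleftrightarrow> (\<forall>i\<in>I. self_dual_code (A i) n (map_word n (\<pi> i) ` C))"
proof
  note sub = linear_codeD(1)[OF lin]
  assume sd: "self_dual_code S n C"
  show "\<forall>i\<in>I. self_dual_code (A i) n (map_word n (\<pi> i) ` C)"
  proof
    fix i assume i: "i \<in> I"
    have "map_word n (\<pi> i) ` C \<subseteq> dual_code (A i) n (map_word n (\<pi> i) ` C)"
    proof (rule image_subsetI)
      fix c assume "c \<in> C"
      with sd sub have "c \<in> dual_code S n C" "c \<in> {..<n} \<rightarrow>\<^sub>E carrier S"
        unfolding self_dual_code_def by blast+
      with i show "map_word n (\<pi> i) c \<in> dual_code (A i) n (map_word n (\<pi> i) ` C)"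
        by (simp add: mem_dual_code_iff[OF sub])
    qed
    moreover have "s \<in> map_word n (\<pi> i) ` C"
      if s: "s \<in> dual_code (A i) n (map_word n (\<pi> i) ` C)" for s
    proof -
      \<comment> \<open>The word \<open>s\<close> is extended by zero words. Zero is orthogonal to
        everything, so the joint lift \<open>x\<close> lies in the dual of \<open>C\<close>, hence
        in \<open>C\<close>, and it projects to \<open>s\<close>.\<close>
      let ?a = "\<lambda>k. if k = i then s else (\<lambda>j\<in>{..<n}. \<zero>\<^bsub>A k\<^esub>)"
      have "?a k \<in> {..<n} \<rightarrow>\<^sub>E carrier (A k)" if "k \<in> I" for k
        using s that by (auto simp: dual_code_def component_zero_closed)
      then obtain x where x: "x \<in> {..<n} \<rightarrow>\<^sub>E carrier S"
        "\<And>k. k \<in> I \<Longrightarrow> map_word n (\<pi> k) x = ?a k"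
        using word_exists[of ?a] by blast
      have zero: "(\<lambda>j\<in>{..<n}. \<zero>\<^bsub>A k\<^esub>) \<in> dual_code (A k) n (map_word n (\<pi> k) ` C)" if k: "k \<in> I" for k
      proof -
        interpret cring "A k" by (rule cring_A) fact
        have "\<pi> k (c j) \<in> carrier (A k)" if "c \<in> C" "j < n" for c j
          using ring_hom_closed[OF hom[OF k] linear_code_mem[OF lin that]] .
        then show ?thesis
          by (auto simp: dual_code_def intro!: add.finprod_one_eqI)
      qed
      have "x \<in> dual_code S n C"
        using x s zero by (simp add: mem_dual_code_iff[OF sub x(1)])
      then show ?thesis
        using sd x(2)[OF i] by (force simp: self_dual_code_def)
    qed
    ultimately show "self_dual_code (A i) n (map_word n (\<pi> i) ` C)"
      using linear_code_map_word[OF lin i] by (auto simp: self_dual_code_def)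
  qed
next
  note sub = linear_codeD(1)[OF lin]
  assume comp: "\<forall>i\<in>I. self_dual_code (A i) n (map_word n (\<pi> i) ` C)"
  \<comment> \<open>Each projected code equals its own dual, so the componentwise criteria for the
    two memberships coincide.\<close>
  have "y \<in> C \<longleftrightarrow> y \<in> dual_code S n C" if y: "y \<in> {..<n} \<rightarrow>\<^sub>E carrier S" for y
    using comp by (auto simp: mem_code_iff[OF lin y] mem_dual_code_iff[OF sub y] self_dual_code_def)
  then have "C = dual_code S n C"
    using sub by (auto simp: dual_code_def)
  with lin show "self_dual_code S n C"
    by (simp add: self_dual_code_def)
qed

end

section \<open>The quotient ring\<close>

text \<open>The order \<open>p ^ k\<close> annihilates \<open>\<one>\<close>, hence so does
  \<open>p\<close>. If \<open>r\<close> did too, a Bezout relation between \<open>r\<close> and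
  \<open>p\<close> would give \<open>\<one> = \<zero>\<close>.\<close>

lemma (in domain) coprime_order_nonzero:
  fixes r p k :: nat
  assumes "Factorial_Ring.prime p" and "gcd r p = 1" and "order R = p ^ k"
  shows "[r] \<cdot> \<one> \<noteq> \<zero>"
proof
  assume r: "[r] \<cdot> \<one> = \<zero>"
  have pow: "[(m * n)] \<cdot> \<one> = ([m] \<cdot> \<one>) \<otimes> ([n] \<cdot> \<one>)" for m n :: nat
    by (simp add: add_pow_ldistr add.nat_pow_pow mult.commute)
  have "[(p ^ k)] \<cdot> \<one> = \<zero>"
    using add.pow_order_eq_1[OF one_closed] assms(3) by (simp add: order_def)
  \<comment> \<open>Induction on the exponent: for \<open>k = 0\<close> the hypothesis reads
    \<open>\<one> = \<zero>\<close>, and otherwise one factor of \<open>p ^ Suc k\<close> vanishes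
    by integrality.\<close>
  then have p: "[p] \<cdot> \<one> = \<zero>"
    by (induction k) (auto simp: pow integral_iff)
  \<comment> \<open>The Bezout lemma on naturals asks for \<open>r\<close> nonzero, which holds
    because \<open>gcd 0 p = p\<close> differs from 1.\<close>
  obtain x y where "r * x = p * y + 1"
    using bezout_nat[of r p] assms(1,2) prime_gt_0_nat by (metis gr0I gcd_0_left_nat One_nat_def mult.commute not_prime_1)
  then have "[(r * x)] \<cdot> \<one> = [(p * y + 1)] \<cdot> \<one>"
    by simp
  then have "\<one> = \<zero>"
    using r p by (simp add: pow add.nat_pow_mult[symmetric] del: add.nat_pow_mult)
  then show False
    by simp
qed

section \<open>Identities in commutative rings, in particular for an element with
  \<open>v^(r+1) = v\<close>\<close>

context cring
begin

text \<open>Instantiated at chosen factors, it brings for example the two idempotents of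
  \<open>(e a) (e' b)\<close> together, so that their product can be rewritten.\<close>

lemma mult_mult_swap:
  assumes "a \<in> carrier R" "b \<in> carrier R" "c \<in> carrier R" "d \<in> carrier R"
  shows "(a \<otimes> b) \<otimes> (c \<otimes> d) = (a \<otimes> c) \<otimes> (b \<otimes> d)"
  using assms by (simp add: m_ac)

lemma add_minus_cancel:
  assumes "a \<in> carrier R" "b \<in> carrier R"
  shows "a \<oplus> (b \<ominus> a) = b"
proof -
  have "a \<oplus> (b \<ominus> a) = a \<oplus> (\<ominus> a \<oplus> b)"
    unfolding a_minus_def using assms by (subst a_comm[of b]) auto
  also have "\<dots> = b"
    using assms by (rule r_neg2)
  finally show ?thesis .
qed

text \<open>Multiplication by \<open>v\<close> raises every exponent by one: the term
  \<open>v\<close> is lost, but the new top term \<open>v^(r+1)\<close> is again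
  \<open>v\<close>.\<close>

lemma geometric_sum_absorbs:
  assumes v: "v \<in> carrier R" and eq: "v [^] Suc r = v" and r: "r > 0"
  shows "v \<otimes> (\<Oplus>i\<in>{1..r}. v [^] i) = (\<Oplus>i\<in>{1..r}. v [^] i)"
proof -
  obtain m where m: "r = Suc m"
    using r gr0_implies_Suc by blast
  let ?g = "\<lambda>i. v [^] Suc i"
  have "(\<Oplus>i\<in>{1..r}. v [^] i) = (\<Oplus>i\<in>Suc ` {..m}. v [^] i)"
    by (simp add: m image_Suc_atMost)
  also have "\<dots> = (\<Oplus>i\<in>{..m}. ?g i)"
    using v by (intro finsum_reindex) auto
  finally have s: "(\<Oplus>i\<in>{1..r}. v [^] i) = (\<Oplus>i\<in>{..m}. ?g i)" .
  have closed: "(\<Oplus>i\<in>{..m}. ?g i) \<in> carrier R" "(\<Oplus>i\<in>{..m}. ?g (Suc i)) \<in> carrier R"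
    using v by (intro finsum_closed Pi_I nat_pow_closed; simp)+
  have "v \<otimes> (\<Oplus>i\<in>{..m}. ?g i) = (\<Oplus>i\<in>{..m}. v \<otimes> ?g i)"
    using v by (intro finsum_rdistr) auto
  also have "\<dots> = (\<Oplus>i\<in>{..m}. ?g (Suc i))"
    using v by (intro finsum_cong') (auto simp: m_ac)
  finally have vs: "v \<otimes> (\<Oplus>i\<in>{..m}. ?g i) = (\<Oplus>i\<in>{..m}. ?g (Suc i))" .
  \<comment> \<open>The sum of \<open>v, ..., v^(r+1)\<close> is split at its first and at its last
    term. Both of these equal \<open>v\<close> and cancel.\<close>
  have "(\<Oplus>i\<in>{..m}. ?g (Suc i)) \<oplus> ?g 0 = (\<Oplus>i\<in>{..Suc m}. ?g i)"
    using v by (intro finsum_Suc2[symmetric]) auto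
  also have "\<dots> = ?g (Suc m) \<oplus> (\<Oplus>i\<in>{..m}. ?g i)"
    using v by (intro finsum_Suc) auto
  also have "?g (Suc m) = v"
    using eq by (simp add: m)
  also have "v \<oplus> (\<Oplus>i\<in>{..m}. ?g i) = (\<Oplus>i\<in>{..m}. ?g i) \<oplus> v"
    using v closed by (simp add: a_comm)
  finally have "(\<Oplus>i\<in>{..m}. ?g (Suc i)) = (\<Oplus>i\<in>{..m}. ?g i)"
    using v closed by simp
  then show ?thesis
    by (simp only: s vs)
qed

text \<open>Iterating \<open>v s = s\<close> shows that every power of \<open>v\<close> fixes
  \<open>s\<close>; hence \<open>s s\<close> is a sum of \<open>r\<close> copies of
  \<open>s\<close>.\<close>

lemma geometric_sum_square:
  assumes v: "v \<in> carrier R" and eq: "v [^] Suc r = v" and r: "r > 0"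
  defines "s \<equiv> \<Oplus>i\<in>{1..r}. v [^] i"
  shows "v [^] (i::nat) \<otimes> s = s" and "s \<otimes> s = ([r] \<cdot> \<one>) \<otimes> s"
proof -
  have s: "s \<in> carrier R"
    unfolding s_def using v by (intro finsum_closed) auto
  have vs: "v \<otimes> s = s"
    using geometric_sum_absorbs[OF v eq r] by (simp add: s_def)
  show pow: "v [^] i \<otimes> s = s" for i :: nat
    by (induction i) (use v s vs in \<open>simp_all add: m_assoc\<close>)
  have "s \<otimes> s = (\<Oplus>i\<in>{1..r}. v [^] i \<otimes> s)"
    unfolding s_def by (rule finsum_ldistr) (use v s in \<open>auto simp: s_def\<close>)
  also have "\<dots> = (\<Oplus>i\<in>{1..r}. s)"
    using s by (intro finsum_cong') (auto simp: pow)
  also have "\<dots> = [r] \<cdot> s"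
    using add.finprod_const[OF s, of "{1..r}"] by simp
  finally show "s \<otimes> s = ([r] \<cdot> \<one>) \<otimes> s"
    using s by (simp add: add_pow_ldistr)
qed

end

text \<open>The condition \<open>r_nonzero\<close> gives the fractions \<open>1/r\<close> and
  \<open>(r-1)/r\<close> their meaning; for a field of order \<open>p ^ k\<close> it is supplied by
  \<open>coprime_order_nonzero\<close>.\<close>

locale idem_quot = field F for F :: "('a, 'b) ring_scheme" (structure) +
  fixes r :: nat
  assumes r_gt_1: "r > 1" and r_nonzero: "[r] \<cdot> \<one> \<noteq> \<zero>"
begin

abbreviation "P \<equiv> (carrier F)[X]"
abbreviation "Q \<equiv> quot_ring F r"

section \<open>Polynomials and their classes modulo \<open>v^(r+1) - v\<close>\<close>

lemma P_domain: "domain P"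
  by (rule univ_poly_is_domain[OF carrier_is_subring])

lemma X_closed: "X \<in> carrier P"
  by (rule var_closed(1)[OF carrier_is_subring])

lemma quot_poly_closed: "quot_poly F r \<in> carrier P"
proof -
  interpret P: domain P by (rule P_domain)
  show ?thesis
    using X_closed by (simp add: quot_poly_def)
qed

lemma Q_cring: "cring Q"
proof -
  interpret P: domain P by (rule P_domain)
  show ?thesis
    unfolding quot_ring_def rupture_def
    by (intro ideal.quotient_is_cring P.cgenideal_ideal quot_poly_closed P.is_cring)
qed

sublocale Q: cring Q
  by (rule Q_cring)

lemma quot_class_hom: "quot_class F r \<in> ring_hom P Q"
  using rupture_surj_hom(1)[OF carrier_is_subring quot_poly_closed]
  by (simp add: quot_class_def[abs_def] quot_ring_def)

lemma quot_class_eq_zeroD: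
  assumes "q \<in> carrier P" and "quot_class F r q = \<zero>\<^bsub>Q\<^esub>"
  obtains g where "g \<in> carrier P" and "q = g \<otimes>\<^bsub>P\<^esub> quot_poly F r"
proof -
  interpret P: domain P by (rule P_domain)
  have "PIdl\<^bsub>P\<^esub> (quot_poly F r) +>\<^bsub>P\<^esub> q = PIdl\<^bsub>P\<^esub> (quot_poly F r)"
    using assms(2) by (simp add: quot_class_def quot_ring_def rupture_def FactRing_def)
  then have "q \<in> PIdl\<^bsub>P\<^esub> (quot_poly F r)"
    using ideal.rcos_const_imp_mem[OF P.cgenideal_ideal[OF quot_poly_closed] assms(1)] by simp
  with that show thesis
    by (auto simp: cgenideal_def)
qed

text \<open>Evaluation at a root of the modulus kills all its multiples. The roots 1 and 0 serve to
  show that \<open>e1\<close> and \<open>e3\<close> do not vanish.\<close>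

lemma quot_class_eq_zero_imp_eval:
  assumes "q \<in> carrier P" and "quot_class F r q = \<zero>\<^bsub>Q\<^esub>" and x: "x \<in> carrier F" "x [^] (r + 1) = x"
  shows "eval q x = \<zero>"
proof -
  interpret ev: ring_hom_cring P F "\<lambda>q. eval q x"
    by (rule eval_cring_hom[OF carrier_is_subring x(1)])
  obtain g where g: "g \<in> carrier P" "q = g \<otimes>\<^bsub>P\<^esub> quot_poly F r"
    by (rule quot_class_eq_zeroD[OF assms(1,2)])
  have "eval (quot_poly F r) x = x [^] (r + 1) \<ominus> x"
    using X_closed x by (simp add: quot_poly_def a_minus_def eval_var)
  then have "eval (quot_poly F r) x = \<zero>"
    using x by (simp add: a_minus_def r_neg)
  then show ?thesis
    using g quot_poly_closed by simp
qed

text \<open>The summands have different degrees \<open>m\<close> and 1, so the larger one survives.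
  The case \<open>m = r + 1\<close> is the modulus, and \<open>m = r\<close> occurs in
  \<open>vv_pow_neq\<close>.\<close>

lemma degree_var_pow_minus_var:
  assumes "m > 1"
  shows "degree (X [^]\<^bsub>P\<^esub> m \<ominus>\<^bsub>P\<^esub> X) = m"
proof -
  interpret P: domain P by (rule P_domain)
  have "degree (X [^]\<^bsub>P\<^esub> m) = m"
    by (simp add: unitary_monom_eq_var_pow[OF carrier_is_subring, symmetric] monom_def)
  moreover have "degree (\<ominus>\<^bsub>P\<^esub> X) = 1"
    using univ_poly_a_inv_degree[OF carrier_is_subring X_closed] by (simp add: var_def)
  moreover have "polynomial (carrier F) (X [^]\<^bsub>P\<^esub> m)" "polynomial (carrier F) (\<ominus>\<^bsub>P\<^esub> X)"
    unfolding univ_poly_carrier using X_closed by simp_all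
  ultimately have "degree (poly_add (X [^]\<^bsub>P\<^esub> m) (\<ominus>\<^bsub>P\<^esub> X)) = m"
    using assms poly_add_degree_eq[OF carrier_is_subring] by simp
  then show ?thesis
    by (simp add: a_minus_def univ_poly_add)
qed

lemma vv_closed: "vv F r \<in> carrier Q"
  unfolding vv_def by (rule ring_hom_closed[OF quot_class_hom X_closed])

lemma quot_class_var_pow: "quot_class F r (X [^]\<^bsub>P\<^esub> (m::nat)) = vv F r [^]\<^bsub>Q\<^esub> m"
proof -
  interpret P: domain P by (rule P_domain)
  interpret ring_hom_cring P Q "quot_class F r"
    by (intro ring_hom_cring.intro ring_hom_cring_axioms.intro quot_class_hom P.is_cring Q_cring)
  show ?thesis
    using X_closed by (simp add: vv_def)
qed

lemma quot_class_var_pow_minus_var: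
  "quot_class F r (X [^]\<^bsub>P\<^esub> (m::nat) \<ominus>\<^bsub>P\<^esub> X) = vv F r [^]\<^bsub>Q\<^esub> m \<ominus>\<^bsub>Q\<^esub> vv F r"
proof -
  interpret P: domain P by (rule P_domain)
  interpret ring_hom_cring P Q "quot_class F r"
    by (intro ring_hom_cring.intro ring_hom_cring_axioms.intro quot_class_hom P.is_cring Q_cring)
  show ?thesis
    using X_closed by (simp add: a_minus_def quot_class_var_pow) (simp add: vv_def)
qed

lemma vv_pow_Suc: "vv F r [^]\<^bsub>Q\<^esub> Suc r = vv F r"
proof -
  interpret P: domain P by (rule P_domain)
  have "quot_class F r (quot_poly F r) = \<zero>\<^bsub>Q\<^esub>"
    using P.a_rcos_zero[OF P.cgenideal_ideal P.cgenideal_self] quot_poly_closed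
    by (simp add: quot_class_def quot_ring_def rupture_def FactRing_def)
  then have "vv F r [^]\<^bsub>Q\<^esub> Suc r \<ominus>\<^bsub>Q\<^esub> vv F r = \<zero>\<^bsub>Q\<^esub>"
    by (simp only: quot_poly_def quot_class_var_pow_minus_var Suc_eq_plus1)
  then show ?thesis
    using vv_closed Q.nat_pow_closed[OF vv_closed, of "Suc r"] by (simp only: Q.r_right_minus_eq)
qed

text \<open>The polynomial \<open>X^r - X\<close> is nonzero of degree \<open>r\<close>, so it is no
  multiple of the modulus, whose degree is \<open>r + 1\<close>.\<close>

lemma vv_pow_neq: "vv F r [^]\<^bsub>Q\<^esub> r \<noteq> vv F r"
proof
  interpret P: domain P by (rule P_domain)
  let ?q = "X [^]\<^bsub>P\<^esub> r \<ominus>\<^bsub>P\<^esub> X"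
  have q: "?q \<in> carrier P" and deg: "degree ?q = r"
    using X_closed r_gt_1 degree_var_pow_minus_var by auto
  assume "vv F r [^]\<^bsub>Q\<^esub> r = vv F r"
  then have "quot_class F r ?q = \<zero>\<^bsub>Q\<^esub>"
    using vv_closed by (simp add: quot_class_var_pow_minus_var)
  then obtain g where "g \<in> carrier P" "?q = g \<otimes>\<^bsub>P\<^esub> quot_poly F r"
    by (rule quot_class_eq_zeroD[OF q])
  then have "quot_poly F r pdivides ?q"
    using quot_poly_closed P.m_comm by (auto simp: pdivides_def factor_def)
  moreover have "?q \<noteq> []"
    using deg r_gt_1 by auto
  ultimately have "degree (quot_poly F r) \<le> degree ?q"
    by (intro pdivides_imp_degree_le[OF carrier_is_subring quot_poly_closed q])
  then show False
    using deg r_gt_1 degree_var_pow_minus_var[of "r + 1"] by (simp add: quot_poly_def)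
qed

lemma scalar_hom: "ring_hom_cring F Q (scalar F r)"
proof -
  have "quot_class F r \<circ> poly_of_const \<in> ring_hom F Q"
    using ring_hom_trans[OF canonical_embedding_is_hom[OF carrier_is_subring] quot_class_hom] by simp
  then show ?thesis
    by (intro ring_hom_cring.intro ring_hom_cring_axioms.intro Q_cring)
       (simp_all add: is_cring scalar_def[abs_def] comp_def)
qed

sublocale scalar: ring_hom_cring F Q "scalar F r"
  by (rule scalar_hom)

end

section \<open>The idempotents and the associated codes\<close>

context idem_quot
begin

text \<open>Here \<open>e1 = rinv vsum\<close>, \<open>e2 = vtop - e1\<close> and \<open>e3 = 1 - vtop\<close>.\<close>

definition "vsum = (\<Oplus>\<^bsub>Q\<^esub>i\<in>{1..r}. vv F r [^]\<^bsub>Q\<^esub> i)"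
definition "vtop = vv F r [^]\<^bsub>Q\<^esub> r"
definition "rinv = scalar F r (inv ([r] \<cdot> \<one>))"

lemma vsum_vtop_rinv_closed [simp]: "vsum \<in> carrier Q" "vtop \<in> carrier Q" "rinv \<in> carrier Q"
proof -
  show "vsum \<in> carrier Q" "vtop \<in> carrier Q"
    using vv_closed by (auto simp: vsum_def vtop_def intro!: Q.finsum_closed)
  show "rinv \<in> carrier Q"
    using r_nonzero by (auto simp: rinv_def field_Units)
qed

section \<open>Relations between the three idempotents, and their non-vanishing\<close>

lemma scalar_add_pow: "scalar F r ([(m::nat)] \<cdot> \<one>) = [m] \<cdot>\<^bsub>Q\<^esub> \<one>\<^bsub>Q\<^esub>"
  by (induction m) (simp_all add: add.nat_pow_Suc Q.add.nat_pow_Suc)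

lemma rinv_mult: "rinv \<otimes>\<^bsub>Q\<^esub> ([r] \<cdot>\<^bsub>Q\<^esub> \<one>\<^bsub>Q\<^esub>) = \<one>\<^bsub>Q\<^esub>"
proof -
  have "[r] \<cdot> \<one> \<in> Units F"
    using r_nonzero by (simp add: field_Units)
  then show ?thesis
    by (simp add: rinv_def scalar_add_pow[symmetric] scalar.hom_mult[symmetric] del: scalar.hom_mult)
qed

text \<open>With \<open>m = r - 1\<close> one has
  \<open>v^(2r) = v^(r+1) v^m = v v^m = v^r\<close>.\<close>

lemma vtop_idem: "vtop \<otimes>\<^bsub>Q\<^esub> vtop = vtop"
proof -
  obtain m where m: "r = Suc m"
    using r_gt_1 by (cases r) auto
  let ?v = "vv F r"
  have "vtop \<otimes>\<^bsub>Q\<^esub> vtop = ?v [^]\<^bsub>Q\<^esub> (r + r)"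
    by (simp only: vtop_def Q.nat_pow_mult[OF vv_closed])
  also have "r + r = Suc r + m"
    using m by simp
  also have "?v [^]\<^bsub>Q\<^esub> (Suc r + m) = ?v [^]\<^bsub>Q\<^esub> Suc r \<otimes>\<^bsub>Q\<^esub> ?v [^]\<^bsub>Q\<^esub> m"
    using vv_closed by (simp only: Q.nat_pow_mult)
  also have "\<dots> = ?v [^]\<^bsub>Q\<^esub> Suc m"
    unfolding vv_pow_Suc by (rule Q.nat_pow_Suc2[OF vv_closed, symmetric])
  also have "\<dots> = vtop"
    by (simp only: vtop_def m[symmetric])
  finally show ?thesis .
qed

lemma e1_eq: "e1 F r = rinv \<otimes>\<^bsub>Q\<^esub> vsum"
  by (simp add: e1_def rinv_def vsum_def)

lemma e3_eq: "e3 F r = \<one>\<^bsub>Q\<^esub> \<ominus>\<^bsub>Q\<^esub> vtop"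
  by (simp add: e3_def vtop_def)

lemma e1_closed [simp]: "e1 F r \<in> carrier Q"
  by (simp add: e1_eq)

text \<open>With \<open>t = v + ... + v^(r-1)\<close>, the definition reads
  \<open>- t/r + (1 - 1/r) v^r\<close>, which regroups to \<open>v^r - (v^r + t)/r\<close>.\<close>

lemma e2_eq: "e2 F r = vtop \<ominus>\<^bsub>Q\<^esub> e1 F r"
proof -
  define t where "t = (\<Oplus>\<^bsub>Q\<^esub>i\<in>{1..r - 1}. vv F r [^]\<^bsub>Q\<^esub> i)"
  have t: "t \<in> carrier Q"
    unfolding t_def using vv_closed by (intro Q.finsum_closed) auto
  have "{1..r} = insert r {1..r - 1}"
    using r_gt_1 by auto
  then have s: "vsum = vtop \<oplus>\<^bsub>Q\<^esub> t"
    unfolding vsum_def t_def vtop_def using vv_closed r_gt_1 by (simp add: Q.finsum_insert)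
  have unit: "[r] \<cdot> \<one> \<in> Units F"
    using r_nonzero by (simp add: field_Units)
  \<comment> \<open>Since \<open>r\<close> is positive, the truncated subtraction
    \<open>r - 1\<close> agrees with subtraction in the field.\<close>
  have "[r] \<cdot> \<one> = [(r - 1)] \<cdot> \<one> \<oplus> \<one>"
    using r_gt_1 by (cases r) (simp_all add: add.nat_pow_Suc)
  then have "[(r - 1)] \<cdot> \<one> = [r] \<cdot> \<one> \<ominus> \<one>"
    by (simp add: a_minus_def a_assoc r_neg)
  then have "([(r - 1)] \<cdot> \<one>) \<otimes> inv ([r] \<cdot> \<one>) = \<one> \<ominus> inv ([r] \<cdot> \<one>)"
    using unit by (simp add: a_minus_def l_distr l_minus)
  then have "scalar F r (([(r - 1)] \<cdot> \<one>) \<otimes> inv ([r] \<cdot> \<one>)) = \<one>\<^bsub>Q\<^esub> \<ominus>\<^bsub>Q\<^esub> rinv"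
    using unit by (simp add: rinv_def a_minus_def)
  then have "e2 F r = (\<ominus>\<^bsub>Q\<^esub> (rinv \<otimes>\<^bsub>Q\<^esub> t)) \<oplus>\<^bsub>Q\<^esub> (\<one>\<^bsub>Q\<^esub> \<ominus>\<^bsub>Q\<^esub> rinv) \<otimes>\<^bsub>Q\<^esub> vtop"
    by (simp add: e2_def rinv_def t_def vtop_def)
  also have "\<dots> = vtop \<ominus>\<^bsub>Q\<^esub> rinv \<otimes>\<^bsub>Q\<^esub> (vtop \<oplus>\<^bsub>Q\<^esub> t)"
    using t by (simp add: a_minus_def Q.l_distr Q.r_distr Q.l_minus Q.minus_add Q.a_ac)
  finally show ?thesis
    by (simp add: e1_eq s)
qed

lemma idem_closed [simp]: "e2 F r \<in> carrier Q" "e3 F r \<in> carrier Q"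
  by (simp_all add: e2_eq e3_eq)

lemma vtop_e1: "vtop \<otimes>\<^bsub>Q\<^esub> e1 F r = e1 F r"
proof -
  have "vtop \<otimes>\<^bsub>Q\<^esub> vsum = vsum"
    unfolding vtop_def vsum_def
    by (rule Q.geometric_sum_square) (use vv_closed vv_pow_Suc r_gt_1 in simp_all)
  then show ?thesis
    using Q.m_lcomm[of vtop rinv vsum] by (simp only: e1_eq vsum_vtop_rinv_closed)
qed

text \<open>From \<open>vsum^2 = r vsum\<close>, one factor \<open>r\<close> cancels against one of
  the two factors \<open>1/r\<close>.\<close>

lemma e1_idem: "e1 F r \<otimes>\<^bsub>Q\<^esub> e1 F r = e1 F r"
proof -
  have "vsum \<otimes>\<^bsub>Q\<^esub> vsum = ([r] \<cdot>\<^bsub>Q\<^esub> \<one>\<^bsub>Q\<^esub>) \<otimes>\<^bsub>Q\<^esub> vsum"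
    unfolding vsum_def
    by (rule Q.geometric_sum_square) (use vv_closed vv_pow_Suc r_gt_1 in simp_all)
  then have "e1 F r \<otimes>\<^bsub>Q\<^esub> e1 F r = (rinv \<otimes>\<^bsub>Q\<^esub> ([r] \<cdot>\<^bsub>Q\<^esub> \<one>\<^bsub>Q\<^esub>)) \<otimes>\<^bsub>Q\<^esub> (rinv \<otimes>\<^bsub>Q\<^esub> vsum)"
    by (simp add: e1_eq Q.mult_mult_swap[of rinv vsum rinv vsum]) (simp add: Q.m_ac)
  then show ?thesis
    by (simp add: rinv_mult e1_eq)
qed

text \<open>Everything is expanded in terms of \<open>e1\<close> and \<open>vtop\<close>, two
  idempotents with \<open>vtop e1 = e1\<close>.\<close>

lemma idem_mult:
  "e1 F r \<otimes>\<^bsub>Q\<^esub> e1 F r = e1 F r" "e1 F r \<otimes>\<^bsub>Q\<^esub> e2 F r = \<zero>\<^bsub>Q\<^esub>" "e1 F r \<otimes>\<^bsub>Q\<^esub> e3 F r = \<zero>\<^bsub>Q\<^esub>"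
  "e2 F r \<otimes>\<^bsub>Q\<^esub> e1 F r = \<zero>\<^bsub>Q\<^esub>" "e2 F r \<otimes>\<^bsub>Q\<^esub> e2 F r = e2 F r" "e2 F r \<otimes>\<^bsub>Q\<^esub> e3 F r = \<zero>\<^bsub>Q\<^esub>"
  "e3 F r \<otimes>\<^bsub>Q\<^esub> e1 F r = \<zero>\<^bsub>Q\<^esub>" "e3 F r \<otimes>\<^bsub>Q\<^esub> e2 F r = \<zero>\<^bsub>Q\<^esub>" "e3 F r \<otimes>\<^bsub>Q\<^esub> e3 F r = e3 F r"
proof -
  have e1_vtop: "e1 F r \<otimes>\<^bsub>Q\<^esub> vtop = e1 F r"
    using vtop_e1 by (simp add: Q.m_comm)
  note [simp] = e1_vtop vtop_e1 e1_idem vtop_idem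
  show "e1 F r \<otimes>\<^bsub>Q\<^esub> e1 F r = e1 F r" "e1 F r \<otimes>\<^bsub>Q\<^esub> e2 F r = \<zero>\<^bsub>Q\<^esub>" "e1 F r \<otimes>\<^bsub>Q\<^esub> e3 F r = \<zero>\<^bsub>Q\<^esub>"
    "e2 F r \<otimes>\<^bsub>Q\<^esub> e1 F r = \<zero>\<^bsub>Q\<^esub>" "e2 F r \<otimes>\<^bsub>Q\<^esub> e2 F r = e2 F r" "e2 F r \<otimes>\<^bsub>Q\<^esub> e3 F r = \<zero>\<^bsub>Q\<^esub>"
    "e3 F r \<otimes>\<^bsub>Q\<^esub> e1 F r = \<zero>\<^bsub>Q\<^esub>" "e3 F r \<otimes>\<^bsub>Q\<^esub> e2 F r = \<zero>\<^bsub>Q\<^esub>" "e3 F r \<otimes>\<^bsub>Q\<^esub> e3 F r = e3 F r"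
    by (simp_all add: e2_eq e3_eq a_minus_def Q.l_distr Q.r_distr Q.l_minus Q.r_minus Q.r_neg Q.l_neg
          Q.minus_add Q.a_ac Q.r_neg1 Q.r_neg2)
qed

lemma idem_sum: "e1 F r \<oplus>\<^bsub>Q\<^esub> e2 F r \<oplus>\<^bsub>Q\<^esub> e3 F r = \<one>\<^bsub>Q\<^esub>"
  by (simp add: e2_eq e3_eq Q.add_minus_cancel)

text \<open>If \<open>e1\<close> vanished, so would \<open>vsum = r e1\<close>; but its lift
  \<open>X + ... + X^r\<close> takes the value \<open>r\<close>, which is nonzero in the field, at
  1.\<close>

lemma e1_nonzero: "e1 F r \<noteq> \<zero>\<^bsub>Q\<^esub>"
proof
  interpret P: domain P by (rule P_domain)
  interpret cls: ring_hom_cring P Q "quot_class F r"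
    by (intro ring_hom_cring.intro ring_hom_cring_axioms.intro quot_class_hom P.is_cring Q_cring)
  interpret ev: ring_hom_cring P F "\<lambda>q. eval q \<one>"
    by (rule eval_cring_hom[OF carrier_is_subring one_closed])
  let ?q = "\<Oplus>\<^bsub>P\<^esub>i\<in>{1..r}. X [^]\<^bsub>P\<^esub> i"
  have q: "?q \<in> carrier P"
    using X_closed by (intro P.finsum_closed) auto
  assume "e1 F r = \<zero>\<^bsub>Q\<^esub>"
  then have "([r] \<cdot>\<^bsub>Q\<^esub> \<one>\<^bsub>Q\<^esub>) \<otimes>\<^bsub>Q\<^esub> (rinv \<otimes>\<^bsub>Q\<^esub> vsum) = \<zero>\<^bsub>Q\<^esub>"
    by (simp add: e1_eq)
  then have "vsum = \<zero>\<^bsub>Q\<^esub>"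
    using rinv_mult by (simp add: Q.m_assoc[symmetric] Q.m_comm[of "[r] \<cdot>\<^bsub>Q\<^esub> \<one>\<^bsub>Q\<^esub>" rinv])
  moreover have "quot_class F r ?q = vsum"
    using X_closed by (subst cls.hom_finsum) (auto simp: vsum_def quot_class_var_pow comp_def)
  ultimately have "eval ?q \<one> = \<zero>"
    using quot_class_eq_zero_imp_eval[OF q] by simp
  moreover have "eval ?q \<one> = (\<Oplus>i\<in>{1..r}. \<one>)"
    using X_closed by (subst ev.hom_finsum) (auto simp: comp_def eval_var intro!: finsum_cong')
  ultimately show False
    using r_nonzero by (simp add: add.finprod_const)
qed

text \<open>If \<open>e2 = 0\<close> then \<open>v\<^sup>r = e1\<close> is fixed by multiplication with \<open>v\<close>, so \<open>v\<^sup>r = v\<^sup>r\<^sup>+\<^sup>1 = v\<close>,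
  which the degree of the modulus rules out.\<close>

lemma e2_nonzero: "e2 F r \<noteq> \<zero>\<^bsub>Q\<^esub>"
proof
  let ?v = "vv F r"
  assume "e2 F r = \<zero>\<^bsub>Q\<^esub>"
  then have eq: "vtop = e1 F r"
    by (simp add: e2_eq)
  have "?v \<otimes>\<^bsub>Q\<^esub> vsum = vsum"
    unfolding vsum_def
    by (rule Q.geometric_sum_absorbs) (use vv_closed vv_pow_Suc r_gt_1 in simp_all)
  then have "?v \<otimes>\<^bsub>Q\<^esub> vtop = vtop"
    using Q.m_lcomm[of ?v rinv vsum] vv_closed by (simp only: eq e1_eq vsum_vtop_rinv_closed)
  moreover have "?v \<otimes>\<^bsub>Q\<^esub> vtop = ?v"
    using vv_closed vv_pow_Suc by (simp add: vtop_def Q.m_comm)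
  ultimately show False
    using vv_pow_neq by (simp add: vtop_def)
qed

text \<open>The lift \<open>1 - X^r\<close> takes the value 1 at the root 0 of the modulus, as
  \<open>r\<close> is positive.\<close>

lemma e3_nonzero: "e3 F r \<noteq> \<zero>\<^bsub>Q\<^esub>"
proof
  interpret P: domain P by (rule P_domain)
  interpret cls: ring_hom_cring P Q "quot_class F r"
    by (intro ring_hom_cring.intro ring_hom_cring_axioms.intro quot_class_hom P.is_cring Q_cring)
  interpret ev: ring_hom_cring P F "\<lambda>q. eval q \<zero>"
    by (rule eval_cring_hom[OF carrier_is_subring zero_closed])
  let ?q = "\<one>\<^bsub>P\<^esub> \<ominus>\<^bsub>P\<^esub> X [^]\<^bsub>P\<^esub> r"
  have q: "?q \<in> carrier P"
    using X_closed by simp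
  assume "e3 F r = \<zero>\<^bsub>Q\<^esub>"
  moreover have "quot_class F r ?q = e3 F r"
    using X_closed by (simp add: a_minus_def quot_class_var_pow e3_eq vtop_def del: cls.hom_pow)
  ultimately have "eval ?q \<zero> = \<zero>"
    using quot_class_eq_zero_imp_eval[OF q] by simp
  moreover have "eval ?q \<zero> = \<one>"
    using X_closed r_gt_1 ev.hom_one by (simp add: a_minus_def eval_var nat_pow_zero del: ev.hom_one)
  ultimately show False
    by simp
qed

text \<open>If \<open>a\<close> and \<open>b\<close> differ, the unit \<open>a - b\<close> of the
  field annihilates \<open>e\<close>, which forces \<open>e\<close> to be zero.\<close>

lemma mult_scalar_inj:
  assumes e: "e \<in> carrier Q" "e \<noteq> \<zero>\<^bsub>Q\<^esub>" and ab: "a \<in> carrier F" "b \<in> carrier F"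
    and eq: "e \<otimes>\<^bsub>Q\<^esub> scalar F r a = e \<otimes>\<^bsub>Q\<^esub> scalar F r b"
  shows "a = b"
proof (rule ccontr)
  assume "a \<noteq> b"
  then have unit: "a \<ominus> b \<in> Units F"
    using ab by (simp add: field_Units)
  have "e = e \<otimes>\<^bsub>Q\<^esub> scalar F r ((a \<ominus> b) \<otimes> inv (a \<ominus> b))"
    using e unit by simp
  also have "\<dots> = (e \<otimes>\<^bsub>Q\<^esub> scalar F r (a \<ominus> b)) \<otimes>\<^bsub>Q\<^esub> scalar F r (inv (a \<ominus> b))"
    using e ab unit by (simp add: Q.m_assoc del: Units_r_inv)
  also have "e \<otimes>\<^bsub>Q\<^esub> scalar F r (a \<ominus> b) = \<zero>\<^bsub>Q\<^esub>"
    using e ab eq by (simp add: a_minus_def Q.r_distr Q.r_minus Q.r_neg)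
  finally show False
    using e unit by simp
qed

section \<open>The subring and its three coordinates\<close>

lemma idem_comb_closed [simp]:
  "\<lbrakk>a \<in> carrier F; b \<in> carrier F; c \<in> carrier F\<rbrakk> \<Longrightarrow> idem_comb F r a b c \<in> carrier Q"
  by (simp add: idem_comb_def)

lemma idem_mult_comb:
  assumes "a \<in> carrier F" "b \<in> carrier F" "c \<in> carrier F"
  shows "e1 F r \<otimes>\<^bsub>Q\<^esub> idem_comb F r a b c = e1 F r \<otimes>\<^bsub>Q\<^esub> scalar F r a"
    and "e2 F r \<otimes>\<^bsub>Q\<^esub> idem_comb F r a b c = e2 F r \<otimes>\<^bsub>Q\<^esub> scalar F r b"
    and "e3 F r \<otimes>\<^bsub>Q\<^esub> idem_comb F r a b c = e3 F r \<otimes>\<^bsub>Q\<^esub> scalar F r c"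
  using assms by (simp_all add: idem_comb_def Q.r_distr Q.m_assoc[symmetric] idem_mult)

text \<open>Multiplying by each idempotent isolates one coefficient, which
  \<open>mult_scalar_inj\<close> then cancels; this is where the non-vanishing of all three
  idempotents enters.\<close>

lemma idem_comb_inj:
  assumes "a \<in> carrier F" "b \<in> carrier F" "c \<in> carrier F"
    and "a' \<in> carrier F" "b' \<in> carrier F" "c' \<in> carrier F"
    and "idem_comb F r a b c = idem_comb F r a' b' c'"
  shows "a = a' \<and> b = b' \<and> c = c'"
  using assms idem_mult_comb[OF assms(1-3)] idem_mult_comb[OF assms(4-6)]
    mult_scalar_inj[OF e1_closed e1_nonzero] mult_scalar_inj[OF idem_closed(1) e2_nonzero]
    mult_scalar_inj[OF idem_closed(2) e3_nonzero] by metis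

lemma idem_comb_one: "idem_comb F r \<one> \<one> \<one> = \<one>\<^bsub>Q\<^esub>"
  by (simp add: idem_comb_def idem_sum)

lemma idem_comb_add:
  assumes "a \<in> carrier F" "b \<in> carrier F" "c \<in> carrier F"
    and "a' \<in> carrier F" "b' \<in> carrier F" "c' \<in> carrier F"
  shows "idem_comb F r a b c \<oplus>\<^bsub>Q\<^esub> idem_comb F r a' b' c' = idem_comb F r (a \<oplus> a') (b \<oplus> b') (c \<oplus> c')"
  using assms by (simp add: idem_comb_def Q.r_distr Q.a_ac)

lemma idem_comb_uminus:
  assumes "a \<in> carrier F" "b \<in> carrier F" "c \<in> carrier F"
  shows "\<ominus>\<^bsub>Q\<^esub> idem_comb F r a b c = idem_comb F r (\<ominus> a) (\<ominus> b) (\<ominus> c)"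
  using assms by (simp add: idem_comb_def Q.r_minus Q.minus_add)

text \<open>Orthogonality removes the mixed terms, so multiplication is coefficientwise.\<close>

lemma idem_comb_mult:
  assumes "a \<in> carrier F" "b \<in> carrier F" "c \<in> carrier F"
    and "a' \<in> carrier F" "b' \<in> carrier F" "c' \<in> carrier F"
  shows "idem_comb F r a b c \<otimes>\<^bsub>Q\<^esub> idem_comb F r a' b' c' = idem_comb F r (a \<otimes> a') (b \<otimes> b') (c \<otimes> c')"
  using assms
  by (simp add: idem_comb_def Q.r_distr Q.l_distr idem_mult
        Q.mult_mult_swap[of "e1 F r"] Q.mult_mult_swap[of "e2 F r"] Q.mult_mult_swap[of "e3 F r"])

lemma mem_sub_ring_iff:
  "x \<in> carrier (sub_ring F r) \<longleftrightarrow>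
    (\<exists>a\<in>carrier F. \<exists>b\<in>carrier F. \<exists>c\<in>carrier F. x = idem_comb F r a b c)"
  unfolding sub_ring_def by simp blast

lemma idem_comb_mem:
  "\<lbrakk>a \<in> carrier F; b \<in> carrier F; c \<in> carrier F\<rbrakk> \<Longrightarrow> idem_comb F r a b c \<in> carrier (sub_ring F r)"
  unfolding mem_sub_ring_iff by blast

lemma sub_ringE:
  assumes "x \<in> carrier (sub_ring F r)"
  obtains a b c where "a \<in> carrier F" "b \<in> carrier F" "c \<in> carrier F" "x = idem_comb F r a b c"
  using assms unfolding mem_sub_ring_iff by blast

lemma sub_ring_cring: "cring (sub_ring F r)"
proof -
  let ?H = "carrier (sub_ring F r)"
  have sub: "?H \<subseteq> carrier Q"
    by (auto simp: mem_sub_ring_iff)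
  have subring: "subring ?H Q"
  proof (rule Q.subringI)
    show "\<one>\<^bsub>Q\<^esub> \<in> ?H"
      using idem_comb_mem[of \<one> \<one> \<one>] by (simp add: idem_comb_one)
    show "\<ominus>\<^bsub>Q\<^esub> x \<in> ?H" if "x \<in> ?H" for x
      using that by (elim sub_ringE) (simp add: idem_comb_uminus idem_comb_mem)
    show "x \<otimes>\<^bsub>Q\<^esub> y \<in> ?H" if "x \<in> ?H" "y \<in> ?H" for x y
      using that by (elim sub_ringE) (simp add: idem_comb_mult idem_comb_mem)
    show "x \<oplus>\<^bsub>Q\<^esub> y \<in> ?H" if "x \<in> ?H" "y \<in> ?H" for x y
      using that by (elim sub_ringE) (simp add: idem_comb_add idem_comb_mem)
  qed (rule sub)
  have "cring (Q\<lparr>carrier := ?H\<rparr>)"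
    using Q.subcring_iff[OF sub] Q.subcringI'[OF subring] by simp
  moreover have "Q\<lparr>carrier := ?H\<rparr> = sub_ring F r"
    by (simp add: sub_ring_def)
  ultimately show ?thesis
    by simp
qed

text \<open>The three coordinates form one family indexed by list position, as
  \<open>ring_decomposition\<close> expects. The values are meaningful on the subring, where the
  inverted map is injective by \<open>idem_comb_inj\<close>.\<close>

definition idem_coord :: "nat \<Rightarrow> 'a list set \<Rightarrow> 'a" where
  "idem_coord i x =
    (case inv_into (carrier F \<times> carrier F \<times> carrier F) (\<lambda>(a, b, c). idem_comb F r a b c) x of
       (a, b, c) \<Rightarrow> [a, b, c] ! i)"

lemma idem_coord_comb:
  assumes "a \<in> carrier F" "b \<in> carrier F" "c \<in> carrier F"
  shows "idem_coord i (idem_comb F r a b c) = [a, b, c] ! i"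
proof -
  let ?f = "\<lambda>(a, b, c). idem_comb F r a b c"
  have "inj_on ?f (carrier F \<times> carrier F \<times> carrier F)"
  proof (rule inj_onI)
    fix x y assume "x \<in> carrier F \<times> carrier F \<times> carrier F" "y \<in> carrier F \<times> carrier F \<times> carrier F" "?f x = ?f y"
    then show "x = y"
      using idem_comb_inj[of "fst x" "fst (snd x)" "snd (snd x)" "fst y" "fst (snd y)" "snd (snd y)"]
      by (auto simp: split_beta prod_eq_iff)
  qed
  from inv_into_f_f[OF this, of "(a, b, c)"] assms show ?thesis
    by (simp add: idem_coord_def)
qed

text \<open>The middle index is written \<open>Suc 0\<close> because the simplifier turns the
  natural number 1 into this form.\<close>

lemma idem_coord_simps [simp]:
  assumes "a \<in> carrier F" "b \<in> carrier F" "c \<in> carrier F"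
  shows "idem_coord 0 (idem_comb F r a b c) = a"
    and "idem_coord (Suc 0) (idem_comb F r a b c) = b"
    and "idem_coord 2 (idem_comb F r a b c) = c"
  using assms by (simp_all add: idem_coord_comb)

lemma sub_ring_sel:
  "mult (sub_ring F r) = mult Q" "add (sub_ring F r) = add Q" "one (sub_ring F r) = one Q"
  by (simp_all add: sub_ring_def)

text \<open>The coordinates are homomorphisms because \<open>idem_comb\<close> computes
  coefficientwise; they determine the element, and \<open>idem_comb\<close> realises any prescribed
  triple.\<close>

lemma sub_ring_decomposition: "ring_decomposition {0, Suc 0, 2} (sub_ring F r) (\<lambda>_. F) idem_coord"
proof (rule ring_decomposition.intro)
  show "idem_coord i \<in> ring_hom (sub_ring F r) F" if "i \<in> {0, Suc 0, 2}" for i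
    using that
    by (intro ring_hom_memI)
       (auto elim!: sub_ringE simp: sub_ring_sel idem_comb_mult idem_comb_add idem_comb_one[symmetric])
  show "x = y" if x: "x \<in> carrier (sub_ring F r)" and y: "y \<in> carrier (sub_ring F r)"
    and eq: "\<And>i. i \<in> {0, Suc 0, 2} \<Longrightarrow> idem_coord i x = idem_coord i y" for x y
    using x y eq[of 0] eq[of "Suc 0"] eq[of 2] by (elim sub_ringE) simp
  show "\<exists>x\<in>carrier (sub_ring F r). \<forall>i\<in>{0, Suc 0, 2}. idem_coord i x = a i"
    if "\<And>i. i \<in> {0, Suc 0, 2} \<Longrightarrow> a i \<in> carrier F" for a
    using that[of 0] that[of "Suc 0"] that[of 2]
    by (intro bexI[of _ "idem_comb F r (a 0) (a (Suc 0)) (a 2)"] idem_comb_mem) simp_all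
qed (simp_all add: sub_ring_cring is_cring)

section \<open>Words over the subring and the associated codes\<close>

lemma word_comb_coord:
  assumes "c \<in> {..<n} \<rightarrow>\<^sub>E carrier (sub_ring F r)"
  shows "word_comb F r n (map_word n (idem_coord 0) c) (map_word n (idem_coord (Suc 0)) c)
    (map_word n (idem_coord 2) c) = c"
proof
  fix j
  show "word_comb F r n (map_word n (idem_coord 0) c) (map_word n (idem_coord (Suc 0)) c)
    (map_word n (idem_coord 2) c) j = c j"
  proof (cases "j < n")
    case True
    with assms have "c j \<in> carrier (sub_ring F r)"
      by auto
    then show ?thesis
      using True by (elim sub_ringE) (simp add: word_comb_def)
  qed (simp add: word_comb_def PiE_arb[OF assms])
qed

lemma coord_word_comb:
  assumes "s \<in> {..<n} \<rightarrow>\<^sub>E carrier F" "t \<in> {..<n} \<rightarrow>\<^sub>E carrier F" "u \<in> {..<n} \<rightarrow>\<^sub>E carrier F"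
  shows "map_word n (idem_coord 0) (word_comb F r n s t u) = s"
    and "map_word n (idem_coord (Suc 0)) (word_comb F r n s t u) = t"
    and "map_word n (idem_coord 2) (word_comb F r n s t u) = u"
proof -
  have mem: "s j \<in> carrier F" "t j \<in> carrier F" "u j \<in> carrier F" if "j < n" for j
    using assms that by auto
  show "map_word n (idem_coord 0) (word_comb F r n s t u) = s"
    "map_word n (idem_coord (Suc 0)) (word_comb F r n s t u) = t"
    "map_word n (idem_coord 2) (word_comb F r n s t u) = u"
    by (simp_all add: map_word_def word_comb_def fun_eq_iff mem
          PiE_arb[OF assms(1)] PiE_arb[OF assms(2)] PiE_arb[OF assms(3)])
qed

text \<open>The words bound by the existential quantifiers are the remaining coordinates of a
  codeword, since \<open>word_comb\<close> and the coordinate maps are inverse to each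
  other.\<close>

lemma assoc_code_eq:
  assumes C: "C \<subseteq> {..<n} \<rightarrow>\<^sub>E carrier (sub_ring F r)"
  shows "assoc_code1 F r n C = map_word n (idem_coord 0) ` C"
    and "assoc_code2 F r n C = map_word n (idem_coord (Suc 0)) ` C"
    and "assoc_code3 F r n C = map_word n (idem_coord 2) ` C"
proof -
  define W where "W = {..<n} \<rightarrow>\<^sub>E carrier F"
  let ?\<pi> = "\<lambda>i. map_word n (idem_coord i)"
  have image: "s \<in> ?\<pi> 0 ` C \<and> t \<in> ?\<pi> (Suc 0) ` C \<and> u \<in> ?\<pi> 2 ` C"
    if "s \<in> W" "t \<in> W" "u \<in> W" and c: "word_comb F r n s t u \<in> C" for s t u
    using imageI[OF c, of "?\<pi> 0"] imageI[OF c, of "?\<pi> (Suc 0)"] imageI[OF c, of "?\<pi> 2"] that(1-3)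
    by (simp add: W_def coord_word_comb)
  have comb: "?\<pi> 0 c \<in> W \<and> ?\<pi> (Suc 0) c \<in> W \<and> ?\<pi> 2 c \<in> W \<and>
      word_comb F r n (?\<pi> 0 c) (?\<pi> (Suc 0) c) (?\<pi> 2 c) \<in> C" if c: "c \<in> C" for c
  proof -
    have "?\<pi> i c \<in> W" if "i \<in> {0, Suc 0, 2}" for i
      unfolding W_def
    proof (rule map_word_PiE)
      fix j assume "j < n"
      with C c have "c j \<in> carrier (sub_ring F r)"
        by auto
      with that show "idem_coord i (c j) \<in> carrier F"
        by (auto elim!: sub_ringE)
    qed
    then show ?thesis
      using word_comb_coord[OF subsetD[OF C c]] c by simp
  qed
  show "assoc_code1 F r n C = ?\<pi> 0 ` C" "assoc_code2 F r n C = ?\<pi> (Suc 0) ` C"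
    "assoc_code3 F r n C = ?\<pi> 2 ` C"
    unfolding assoc_code1_def assoc_code2_def assoc_code3_def power_module_sel W_def[symmetric]
    using image comb by blast+
qed

end

theorem corollary6:
  fixes F :: "('a, 'b) ring_scheme" and p k r n :: nat
    and C :: "(nat \<Rightarrow> 'a list set) set"
  assumes "Factorial_Ring.prime p" and "k \<ge> 1" and "r > 1" and "gcd r p = 1"
    and "field F" and "order F = p ^ k"
    and "linear_code (sub_ring F r) n C"
  shows "cyclic_code (sub_ring F r) n C \<and> self_dual_code (sub_ring F r) n C \<longleftrightarrow>
         (cyclic_code F n (assoc_code1 F r n C) \<and> self_dual_code F n (assoc_code1 F r n C)) \<and>
         (cyclic_code F n (assoc_code2 F r n C) \<and> self_dual_code F n (assoc_code2 F r n C)) \<and>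
         (cyclic_code F n (assoc_code3 F r n C) \<and> self_dual_code F n (assoc_code3 F r n C))"
proof -
  interpret field F by fact
  interpret idem_quot F r
    by unfold_locales (use assms coprime_order_nonzero in auto)
  interpret ring_decomposition "{0, Suc 0, 2}" "sub_ring F r" "\<lambda>_. F" idem_coord
    by (rule sub_ring_decomposition)
  show ?thesis
    \<comment> \<open>The associated codes become projections of \<open>C\<close>, and
      quantification over the three indices becomes a conjunction; only its regrouping is
      left.\<close>
    unfolding assoc_code_eq[OF linear_codeD(1)[OF assms(7)]]
      cyclic_code_iff[OF assms(7)] self_dual_code_iff[OF assms(7)]
    by auto
qed

end
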